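(* On the assumption that a dynamic scheduler (scheduling by earliest absolute deadline) is free to decide which job is scheduled if the absolute deadlines are equal, the worst-case response times of different tasks occur in different schedules, and therefore the worst-case response time is overestimated: for a considered job of task $\tau$ with request time $t^r_\tau$ and absolute deadline $D_\tau$, and an interfering task $\tau'$, for every $t\in\mathbb R$ and interval $\Delta_{a,b}=[t_a,t_b)$, $$\sum_{(e,n)\in N_{\tau'}(t,\Delta_{a,b})} C^n_{\tau',e}\,\big[H^l(D_\tau-D_{\tau',e,n})+\delta_{D_{\tau',e,n},D_\tau}\,H^u(t^r_\tau-t^r_{\tau',e,n})\big]\ \le\ \sum_{(e,n)\in N_{\tau'}(t,\Delta_{a,b})} C^n_{\tau',e}\,H^u(D_\tau-D_{\tau',e,n}).$$ The left-hand side is the interference request bound when jobs with equal absolute deadlines are served according to their request times. The right-hand side is the interference request bound when any job may be scheduled if absolute deadlines are equal.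
   Context: Jobs are executed preemptively on one processor. The response time of a job is its finishing time minus its request time, and the worst-case response time of a task is the maximal response time of its jobs. A task $\tau'$ has a finite event list $E_{\tau'}$ of event tuples $e$ with period $p_e\ge0$, minimal distance $a_e\ge0$ and relative deadline $d_{\tau',e}$, and a bound $k\in\mathbb N\cup\{\infty\}$ on the number of events per tuple. Its job $(e,n)$, $e\in E_{\tau'}$, $0\le n\le k-1$, has request time $t^r_{\tau',e,n}=a_e+np_e$, execution time $C^n_{\tau',e}\ge0$ and absolute deadline $D_{\tau',e,n}=a_e+np_e+d_{\tau',e}$. $N_{\tau'}(t,\Delta_{a,b})$ is the set of jobs $(e,n)$ of $\tau'$ whose events are counted by the event bound, i.e. with $t_a\le a_e+np_e\le t$ and $a_e+np_e<t_b$. $H^u(x)=1$ for $x\ge0$, $0$ for $x<0$; $H^l(x)=1$ for $x>0$, $0$ for $x\le0$; $\delta_{x,y}$ is the Kronecker delta.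
   Formalization: That worst cases of different tasks occur in different schedules is false for jobs that never compete; it is stated for jobs of two tasks with equal absolute deadlines, both pending at some time, with finite worst-case response times, in schedules with finitely many switches in bounded time. *)

theory Defs
  imports "HOL-Analysis.Analysis" "HOL-Library.Extended_Nat"
begin

record event_tuple =
  period :: real
  distance :: real
  rel_deadline :: real

text \<open>
  Events are referred to by their position in the event list, so that an event list may contain
  the same tuple more than once. \<open>job_exec T e n\<close> is the execution time of job \<open>(e, n)\<close>.
\<close>

record task =
  events :: "event_tuple list"
  job_exec :: "nat \<Rightarrow> nat \<Rightarrow> real"
  event_bound :: enat

definition jobs :: "task \<Rightarrow> (nat \<times> nat) set" where
  "jobs T = {(e, n). e < length (events T) \<and> enat n < event_bound T}"

definition request :: "task \<Rightarrow> nat \<Rightarrow> nat \<Rightarrow> real" where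
  "request T e n = distance (events T ! e) + real n * period (events T ! e)"

definition deadline :: "task \<Rightarrow> nat \<Rightarrow> nat \<Rightarrow> real" where
  "deadline T e n =
     distance (events T ! e) + real n * period (events T ! e) + rel_deadline (events T ! e)"

definition wf_task :: "task \<Rightarrow> bool" where
  "wf_task T \<longleftrightarrow>
     (\<forall>ev \<in> set (events T). period ev \<ge> 0 \<and> distance ev \<ge> 0) \<and>
     (\<forall>(e, n) \<in> jobs T. job_exec T e n \<ge> 0)"

definition counted_jobs :: "task \<Rightarrow> real \<Rightarrow> real \<Rightarrow> real \<Rightarrow> (nat \<times> nat) set" where
  "counted_jobs T t t\<^sub>a t\<^sub>b =
     {(e, n) \<in> jobs T. t\<^sub>a \<le> request T e n \<and> request T e n \<le> t \<and> request T e n < t\<^sub>b}"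

definition H_u :: "real \<Rightarrow> real" where
  "H_u x = (if x \<ge> 0 then 1 else 0)"

definition H_l :: "real \<Rightarrow> real" where
  "H_l x = (if x > 0 then 1 else 0)"

definition kronecker :: "real \<Rightarrow> real \<Rightarrow> real" where
  "kronecker x y = (if x = y then 1 else 0)"

text \<open>
  A task system is a family \<open>\<Gamma>\<close> of tasks indexed by a type; a job of the system is
  \<open>(i, e, n)\<close>, the job \<open>(e, n)\<close> of task \<open>\<Gamma> i\<close>.
\<close>

type_synonym 'i system = "'i \<Rightarrow> task"
type_synonym 'i job = "'i \<times> nat \<times> nat"

definition is_job :: "'i system \<Rightarrow> 'i job \<Rightarrow> bool" where
  "is_job \<Gamma> = (\<lambda>(i, e, n). (e, n) \<in> jobs (\<Gamma> i))"

definition req :: "'i system \<Rightarrow> 'i job \<Rightarrow> real" where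
  "req \<Gamma> = (\<lambda>(i, e, n). request (\<Gamma> i) e n)"

definition dl :: "'i system \<Rightarrow> 'i job \<Rightarrow> real" where
  "dl \<Gamma> = (\<lambda>(i, e, n). deadline (\<Gamma> i) e n)"

definition cost :: "'i system \<Rightarrow> 'i job \<Rightarrow> real" where
  "cost \<Gamma> = (\<lambda>(i, e, n). job_exec (\<Gamma> i) e n)"

text \<open>
  A policy \<open>P\<close> tells by \<open>P \<Gamma> j j'\<close> whether job \<open>j\<close> may be served while \<open>j'\<close> is pending as well.
  Both policies below schedule by earliest absolute deadline; they differ in whether a tie
  may be broken arbitrarily or has to be broken by request time.
\<close>

type_synonym 'i policy = "'i system \<Rightarrow> 'i job \<Rightarrow> 'i job \<Rightarrow> bool"

definition edf_free :: "'i policy" where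
  "edf_free \<Gamma> j j' \<longleftrightarrow> dl \<Gamma> j \<le> dl \<Gamma> j'"

definition edf_by_request :: "'i policy" where
  "edf_by_request \<Gamma> j j' \<longleftrightarrow>
     dl \<Gamma> j < dl \<Gamma> j' \<or> dl \<Gamma> j = dl \<Gamma> j' \<and> req \<Gamma> j \<le> req \<Gamma> j'"

text \<open>
  The total execution time of the counted jobs of task \<open>i\<close> that may be served before job \<open>j\<close>.
  Sums are taken in the extended nonnegative reals: for period \<open>0\<close> and event bound \<open>\<infinity>\<close> there
  may be infinitely many counted jobs.
\<close>

definition interference_request_bound ::
  "'i policy \<Rightarrow> 'i system \<Rightarrow> 'i job \<Rightarrow> 'i \<Rightarrow> real \<Rightarrow> real \<Rightarrow> real \<Rightarrow> ennreal" where
  "interference_request_bound P \<Gamma> j i t t\<^sub>a t\<^sub>b =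
     (\<Sum>\<^sub>\<infinity>(e, n) \<in> {(e, n) \<in> counted_jobs (\<Gamma> i) t t\<^sub>a t\<^sub>b. P \<Gamma> (i, e, n) j}.
        ennreal (job_exec (\<Gamma> i) e n))"

text \<open>
  A schedule gives the job executed at each time, \<open>None\<close> meaning that the processor is idle.
  Only times \<open>t \<ge> 0\<close> matter, since no job is requested earlier.
\<close>

type_synonym 'i schedule = "real \<Rightarrow> 'i job option"

definition service :: "'i schedule \<Rightarrow> 'i job \<Rightarrow> real \<Rightarrow> real" where
  "service \<sigma> j t = measure lebesgue {u \<in> {0..<t}. \<sigma> u = Some j}"

definition pending :: "'i system \<Rightarrow> 'i schedule \<Rightarrow> real \<Rightarrow> 'i job \<Rightarrow> bool" where
  "pending \<Gamma> \<sigma> t j \<longleftrightarrow> is_job \<Gamma> j \<and> req \<Gamma> j \<le> t \<and> service \<sigma> j t < cost \<Gamma> j"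

text \<open>
  The first two conditions say that there are only finitely many context switches in bounded
  time. They make \<open>service\<close> meaningful and exclude two jobs alternating infinitely often before
  a common finishing time.
\<close>

definition schedule_of :: "'i policy \<Rightarrow> 'i system \<Rightarrow> 'i schedule \<Rightarrow> bool" where
  "schedule_of P \<Gamma> \<sigma> \<longleftrightarrow>
     (\<forall>t\<ge>0. \<forall>\<^sub>F u in at_right t. \<sigma> u = \<sigma> t) \<and>
     (\<forall>t>0. \<exists>x. \<forall>\<^sub>F u in at_left t. \<sigma> u = x) \<and>
     (\<forall>t\<ge>0. case \<sigma> t of
        None \<Rightarrow> \<forall>j. \<not> pending \<Gamma> \<sigma> t j
      | Some j \<Rightarrow> pending \<Gamma> \<sigma> t j \<and> (\<forall>j'. pending \<Gamma> \<sigma> t j' \<longrightarrow> P \<Gamma> j j'))"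

text \<open>The finishing time of a job that never completes is \<open>\<infinity>\<close>.\<close>

definition finishing_time :: "'i system \<Rightarrow> 'i schedule \<Rightarrow> 'i job \<Rightarrow> ereal" where
  "finishing_time \<Gamma> \<sigma> j = Inf (ereal ` {t. req \<Gamma> j \<le> t \<and> cost \<Gamma> j \<le> service \<sigma> j t})"

definition response_time :: "'i system \<Rightarrow> 'i schedule \<Rightarrow> 'i job \<Rightarrow> ereal" where
  "response_time \<Gamma> \<sigma> j = finishing_time \<Gamma> \<sigma> j - ereal (req \<Gamma> j)"

definition wcrt :: "'i policy \<Rightarrow> 'i system \<Rightarrow> 'i \<Rightarrow> ereal" where
  "wcrt P \<Gamma> i =
     Sup {response_time \<Gamma> \<sigma> (i, e, n) | \<sigma> e n. schedule_of P \<Gamma> \<sigma> \<and> (e, n) \<in> jobs (\<Gamma> i)}"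

end

theory Submission
  imports Defs
begin

text \<open>
  The only claim that is not immediate is the last one. Suppose that two jobs with equal deadlines
  are pending at the same time \<open>u\<close> and attain the worst cases of their tasks in the same schedule.
  They cannot finish simultaneously, because only one of them is served immediately before a
  finishing time. If \<open>j1\<close> finishes before \<open>j2\<close>, redistribute the time that the two jobs get from
  \<open>u\<close> on, serving \<open>j2\<close> first. As their deadlines are equal, this is again a schedule with free
  tie-breaking, and now \<open>j1\<close> finishes only when \<open>j2\<close> did, contradicting the maximality
  of its response time.
\<close>

subsection \<open>Interference request bounds\<close>

text \<open>With the indicator of the policy as weight, jobs that may not be served contribute zero
  terms, so dropping them from the index set leaves the sum unchanged.\<close>

lemma interference_request_bound_eq:
  assumes "\<And>e n. (e, n) \<in> counted_jobs (\<Gamma> i) t t\<^sub>a t\<^sub>b \<Longrightarrow> w e n = (if P \<Gamma> (i, e, n) j then 1 else 0)"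
  shows "(\<Sum>\<^sub>\<infinity>(e, n)\<in>counted_jobs (\<Gamma> i) t t\<^sub>a t\<^sub>b. ennreal (job_exec (\<Gamma> i) e n * w e n))
       = interference_request_bound P \<Gamma> j i t t\<^sub>a t\<^sub>b"
  unfolding interference_request_bound_def
  by (rule infsum_cong_neutral) (auto simp: assms)

text \<open>Every family in \<open>ennreal\<close> is summable, so a termwise comparison suffices
  even for infinitely many jobs.\<close>

lemma weighted_interference_mono:
  fixes c w w' :: "nat \<Rightarrow> nat \<Rightarrow> real"
  assumes "\<And>e n. (e, n) \<in> N \<Longrightarrow> 0 \<le> c e n" "\<And>e n. (e, n) \<in> N \<Longrightarrow> w e n \<le> w' e n"
  shows "(\<Sum>\<^sub>\<infinity>(e, n)\<in>N. ennreal (c e n * w e n)) \<le> (\<Sum>\<^sub>\<infinity>(e, n)\<in>N. ennreal (c e n * w' e n))"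
  by (rule infsum_mono)
     (auto intro!: nonneg_summable_on_complete ennreal_leI mult_left_mono assms)

section \<open>Monotonicity in the policy\<close>

lemma schedule_of_mono:
  assumes "schedule_of P \<Gamma> \<sigma>" "\<And>j j'. P \<Gamma> j j' \<Longrightarrow> Q \<Gamma> j j'"
  shows "schedule_of Q \<Gamma> \<sigma>"
  using assms unfolding schedule_of_def by (auto split: option.splits)

text \<open>A more permissive policy admits every schedule of the stricter one, so its supremum runs
  over a larger set.\<close>

lemma wcrt_mono:
  assumes "\<And>j j'. P \<Gamma> j j' \<Longrightarrow> Q \<Gamma> j j'"
  shows "wcrt P \<Gamma> i \<le> wcrt Q \<Gamma> i"
proof -
  have "schedule_of Q \<Gamma> \<sigma>" if "schedule_of P \<Gamma> \<sigma>" for \<sigma>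
    using that assms by (rule schedule_of_mono)
  then show ?thesis
    unfolding wcrt_def by (intro Sup_subset_mono) blast
qed

subsection \<open>Service received in right-continuous schedules\<close>

text \<open>Split off from \<open>schedule_of\<close> because measurability and continuity of
  service rest on this condition alone; they can thus be used for an exchanged schedule before it is
  known to obey the policy.\<close>

definition right_const :: "'i schedule \<Rightarrow> bool" where
  "right_const \<sigma> \<longleftrightarrow> (\<forall>t\<ge>0. \<forall>\<^sub>F u in at_right t. \<sigma> u = \<sigma> t)"

text \<open>
  The set is a lower limit of sets that depend only on a floor: the grid points
  \<open>(\<lfloor>(n+1)x\<rfloor>+1)/(n+1)\<close> tend to \<open>x\<close> strictly from the right.
\<close>
lemma right_const_sets:
  assumes "right_const \<sigma>"
  shows "{x. 0 \<le> x \<and> \<sigma> x = Some j} \<in> sets lebesgue"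
proof -
  define g where "g n x = real_of_int (\<lfloor>real (Suc n) * x\<rfloor> + 1) / real (Suc n)" for n and x :: real
  have g_gt: "x < g n x" for n x
  proof -
    have "real (Suc n) * x < real_of_int (\<lfloor>real (Suc n) * x\<rfloor> + 1)" by linarith
    then show ?thesis unfolding g_def by (simp add: pos_less_divide_eq mult.commute del: of_nat_Suc)
  qed
  have g_le: "g n x \<le> x + inverse (real (Suc n))" for n x
  proof -
    have "real_of_int (\<lfloor>real (Suc n) * x\<rfloor> + 1) \<le> real (Suc n) * x + 1" by linarith
    also have "\<dots> = (x + inverse (real (Suc n))) * real (Suc n)"
      by (simp add: distrib_right del: of_nat_Suc)
    finally show ?thesis unfolding g_def by (simp only: pos_divide_le_eq of_nat_0_less_iff zero_less_Suc)
  qed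
  have "filterlim (\<lambda>n. g n x) (at_right x) sequentially" for x
  proof -
    have "(\<lambda>n. x + inverse (real (Suc n))) \<longlonglongrightarrow> x + 0"
      by (rule tendsto_add[OF tendsto_const LIMSEQ_inverse_real_of_nat])
    then have upper: "(\<lambda>n. x + inverse (real (Suc n))) \<longlonglongrightarrow> x" by simp
    have "(\<lambda>n. g n x) \<longlonglongrightarrow> x"
      by (rule real_tendsto_sandwich[OF _ _ tendsto_const upper])
         (simp_all add: always_eventually g_le less_imp_le[OF g_gt] del: of_nat_Suc)
    then show ?thesis
      unfolding filterlim_at by (simp add: g_gt less_imp_neq[OF g_gt, symmetric])
  qed
  note lim = this
  have ev: "\<forall>\<^sub>F n in sequentially. \<sigma> (g n x) = \<sigma> x" if "0 \<le> x" for x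
  proof -
    from assms that have "\<forall>\<^sub>F u in at_right x. \<sigma> u = \<sigma> x" by (simp add: right_const_def)
    from eventually_compose_filterlim[OF this lim] show ?thesis .
  qed
  have "(\<sigma> x = Some j) \<longleftrightarrow> (\<forall>\<^sub>F n in sequentially. \<sigma> (g n x) = Some j)" if "0 \<le> x" for x
  proof
    assume "\<forall>\<^sub>F n in sequentially. \<sigma> (g n x) = Some j"
    with ev[OF that] have "\<forall>\<^sub>F n in sequentially. \<sigma> x = Some j"
      by eventually_elim simp
    then show "\<sigma> x = Some j" by simp
  qed (use ev[OF that] in simp)
  then have eq: "{x. 0 \<le> x \<and> \<sigma> x = Some j}
      = {0..} \<inter> {x \<in> space borel. \<forall>\<^sub>F n in sequentially. \<sigma> (g n x) = Some j}"
    by auto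
  have "{x \<in> space borel. \<sigma> (g n x) = Some j} \<in> sets borel" for n
  proof -
    \<comment> \<open>\<open>\<sigma> (g n x)\<close> depends on \<open>x\<close> only through the
      floor, and every set of integers is measurable in \<open>count_space UNIV\<close>.\<close>
    have "(\<lambda>x::real. \<lfloor>real (Suc n) * x\<rfloor>) \<in> borel \<rightarrow>\<^sub>M count_space UNIV"
      by measurable
    from measurable_sets[OF this, of "{k. \<sigma> (real_of_int (k + 1) / real (Suc n)) = Some j}"]
    show ?thesis
      by (simp add: g_def vimage_def)
  qed
  then have "{x \<in> space borel. \<forall>\<^sub>F n in sequentially. \<sigma> (g n x) = Some j} \<in> sets borel"
    unfolding eventually_sequentially
    by (intro sets.sets_Collect_countable_Ex sets.sets_Collect_countable_All
              sets.sets_Collect_imp) auto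
  then have "{x. 0 \<le> x \<and> \<sigma> x = Some j} \<in> sets borel"
    unfolding eq by (intro sets.Int) auto
  then show ?thesis by simp
qed

lemma right_const_lmeasurable:
  assumes "right_const \<sigma>" "0 \<le> a"
  shows "{x \<in> {a..<b}. \<sigma> x = Some j} \<in> lmeasurable"
proof -
  have "{x \<in> {a..<b}. \<sigma> x = Some j} = {x. 0 \<le> x \<and> \<sigma> x = Some j} \<inter> {a..<b}"
    using assms(2) by auto
  moreover have "{a..<b} \<in> lmeasurable"
    by (rule bounded_set_imp_lmeasurable) auto
  ultimately show ?thesis
    using right_const_sets[OF assms(1)] fmeasurable_Int_fmeasurable by (metis inf_commute)
qed

lemma service_diff:
  assumes "right_const \<sigma>" "0 \<le> a" "a \<le> b"
  shows "service \<sigma> j b - service \<sigma> j a = measure lebesgue {x \<in> {a..<b}. \<sigma> x = Some j}"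
proof -
  have "{x \<in> {0..<b}. \<sigma> x = Some j}
      = {x \<in> {0..<a}. \<sigma> x = Some j} \<union> {x \<in> {a..<b}. \<sigma> x = Some j}"
    using assms by auto
  moreover have "measure lebesgue ({x \<in> {0..<a}. \<sigma> x = Some j} \<union> {x \<in> {a..<b}. \<sigma> x = Some j})
      = service \<sigma> j a + measure lebesgue {x \<in> {a..<b}. \<sigma> x = Some j}"
    unfolding service_def
    by (intro measure_Un_AE AE_I2 right_const_lmeasurable assms order_refl) auto
  ultimately show ?thesis
    by (simp add: service_def)
qed

lemma service_nonneg: "0 \<le> service \<sigma> j t"
  by (simp add: service_def)

lemma service_nonpos_time: "t \<le> 0 \<Longrightarrow> service \<sigma> j t = 0"
  by (simp add: service_def)

lemma service_mono:
  assumes "right_const \<sigma>" "s \<le> t"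
  shows "service \<sigma> j s \<le> service \<sigma> j t"
proof (cases "0 \<le> s")
  case True
  have "0 \<le> service \<sigma> j t - service \<sigma> j s"
    unfolding service_diff[OF assms(1) True assms(2)] by (rule measure_nonneg)
  then show ?thesis by simp
qed (simp add: service_nonpos_time service_nonneg)

lemma service_diff_le:
  assumes "right_const \<sigma>" "s \<le> t"
  shows "service \<sigma> j t - service \<sigma> j s \<le> t - s"
proof -
  have *: "service \<sigma> j b - service \<sigma> j a \<le> b - a" if "0 \<le> a" "a \<le> b" for a b
  proof -
    have "{a..<b} \<in> lmeasurable"
      by (rule bounded_set_imp_lmeasurable) auto
    then have "measure lebesgue {x \<in> {a..<b}. \<sigma> x = Some j} \<le> measure lebesgue {a..<b}"
      using fmeasurableD[OF right_const_lmeasurable[OF assms(1) that(1)]]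
      by (intro measure_mono_fmeasurable) auto
    then show ?thesis
      using service_diff[OF assms(1) that, of j] that by simp
  qed
  show ?thesis
    using *[of s t] *[of 0 t] assms(2) service_nonpos_time[of s \<sigma> j] service_nonpos_time[of t \<sigma> j]
      service_nonpos_time[of 0 \<sigma> j]
    by (cases "0 \<le> s"; cases "0 \<le> t") auto
qed

text \<open>At most one unit of service per unit of time makes service 1-Lipschitz. Continuity lets
  the intermediate value theorem find exact service levels and makes the set of completion times
  closed.\<close>

lemma continuous_on_service:
  assumes "right_const \<sigma>"
  shows "continuous_on S (service \<sigma> j)"
proof (rule lipschitz_on_continuous_on[of 1], rule lipschitz_onI)
  fix x y
  show "dist (service \<sigma> j x) (service \<sigma> j y) \<le> 1 * dist x y"
    using service_diff_le[OF assms, of x y j] service_diff_le[OF assms, of y x j]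
      service_mono[OF assms, of x y j] service_mono[OF assms, of y x j]
    by (cases "x \<le> y") (auto simp: dist_real_def)
qed simp

text \<open>The endpoint \<open>a\<close> is a null set, so a condition on the open interval is
  enough; this fits what a left neighbourhood provides.\<close>

lemma service_const:
  assumes "right_const \<sigma>" "0 \<le> a" "a \<le> b" "\<And>x. a < x \<Longrightarrow> x < b \<Longrightarrow> \<sigma> x \<noteq> Some j"
  shows "service \<sigma> j b = service \<sigma> j a"
proof -
  have "{x \<in> {a..<b}. \<sigma> x = Some j} \<subseteq> {a}"
  proof safe
    fix x assume "x \<in> {a..<b}" "\<sigma> x = Some j"
    then show "x = a" using assms(4)[of x] by (cases "x = a") auto
  qed
  then have "negligible {x \<in> {a..<b}. \<sigma> x = Some j}"
    using negligible_subset negligible_sing by blast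
  then show ?thesis
    using service_diff[OF assms(1-3), of j] by (simp add: negligible_imp_measure0)
qed

text \<open>If the service overshot, it would equal the cost at some earlier \<open>s\<close>; after
  \<open>s\<close> the job is no longer pending, hence never served again.\<close>

lemma service_le_cost:
  assumes "right_const \<sigma>" "0 \<le> cost \<Gamma> j" "\<And>t. 0 \<le> t \<Longrightarrow> \<sigma> t = Some j \<Longrightarrow> pending \<Gamma> \<sigma> t j"
  shows "service \<sigma> j t \<le> cost \<Gamma> j"
proof (rule ccontr)
  assume "\<not> ?thesis"
  then have gt: "cost \<Gamma> j < service \<sigma> j t" by simp
  with assms(2) have "0 \<le> t"
    using service_nonpos_time[of t \<sigma> j] by (cases "0 \<le> t") auto
  moreover have "service \<sigma> j 0 \<le> cost \<Gamma> j"
    using assms(2) by (simp add: service_nonpos_time)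
  ultimately obtain s where s: "0 \<le> s" "s \<le> t" "service \<sigma> j s = cost \<Gamma> j"
    using IVT'[OF _ less_imp_le[OF gt] _ continuous_on_service[OF assms(1)]] by metis
  have "service \<sigma> j t = service \<sigma> j s"
  proof (rule service_const[OF assms(1) s(1,2)])
    fix x assume "s < x" "x < t"
    then have "\<not> pending \<Gamma> \<sigma> x j"
      using service_mono[OF assms(1), of s x j] s(3) by (simp add: pending_def)
    then show "\<sigma> x \<noteq> Some j"
      using assms(3)[of x] s(1) \<open>s < x\<close> by auto
  qed
  with gt s show False by simp
qed

text \<open>Completion times form a closed set by continuity of service, and the request bounds it
  below, so its infimum is a member.\<close>

lemma finishing_time_attained:
  assumes "right_const \<sigma>" "finishing_time \<Gamma> \<sigma> j \<noteq> \<infinity>"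
  obtains f where "finishing_time \<Gamma> \<sigma> j = ereal f" "req \<Gamma> j \<le> f" "cost \<Gamma> j \<le> service \<sigma> j f"
    "\<And>t. req \<Gamma> j \<le> t \<Longrightarrow> cost \<Gamma> j \<le> service \<sigma> j t \<Longrightarrow> f \<le> t"
proof -
  define F where "F = {t. req \<Gamma> j \<le> t \<and> cost \<Gamma> j \<le> service \<sigma> j t}"
  have fin: "finishing_time \<Gamma> \<sigma> j = Inf (ereal ` F)"
    by (simp add: finishing_time_def F_def)
  \<comment> \<open>The infimum of the empty set is \<infinity>.\<close>
  have ne: "F \<noteq> {}"
    using assms(2) by (auto simp: fin top_ereal_def)
  have bdd: "bdd_below F" unfolding F_def by (rule bdd_belowI[of _ "req \<Gamma> j"]) auto
  have "closed F" unfolding F_def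
    by (intro closed_Collect_conj closed_Collect_le continuous_on_service assms continuous_intros)
  then have mem: "Inf F \<in> F" using closed_contains_Inf ne bdd by blast
  have low: "Inf F \<le> t" if "t \<in> F" for t using that bdd by (rule cInf_lower)
  have "Inf (ereal ` F) = ereal (Inf F)"
    by (rule antisym) (auto intro!: Inf_lower Inf_greatest mem low)
  with fin show thesis
    using that[of "Inf F"] mem low by (simp add: F_def)
qed

section \<open>Schedules of a policy and their finishing times\<close>

lemma schedule_of_right_const: "schedule_of P \<Gamma> \<sigma> \<Longrightarrow> right_const \<sigma>"
  by (simp add: schedule_of_def right_const_def)

lemma schedule_of_left_limit:
  "schedule_of P \<Gamma> \<sigma> \<Longrightarrow> 0 < t \<Longrightarrow> \<exists>x. \<forall>\<^sub>F u in at_left t. \<sigma> u = x"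
  by (simp add: schedule_of_def)

lemma schedule_of_work:
  assumes "schedule_of P \<Gamma> \<sigma>" "0 \<le> t"
  shows "case \<sigma> t of None \<Rightarrow> \<forall>j. \<not> pending \<Gamma> \<sigma> t j
    | Some j \<Rightarrow> pending \<Gamma> \<sigma> t j \<and> (\<forall>j'. pending \<Gamma> \<sigma> t j' \<longrightarrow> P \<Gamma> j j')"
  using assms unfolding schedule_of_def by blast

lemma schedule_of_pending:
  "schedule_of P \<Gamma> \<sigma> \<Longrightarrow> 0 \<le> t \<Longrightarrow> \<sigma> t = Some j \<Longrightarrow> pending \<Gamma> \<sigma> t j"
  by (drule (1) schedule_of_work) simp

lemma schedule_of_policy:
  "schedule_of P \<Gamma> \<sigma> \<Longrightarrow> 0 \<le> t \<Longrightarrow> \<sigma> t = Some j \<Longrightarrow> pending \<Gamma> \<sigma> t j' \<Longrightarrow> P \<Gamma> j j'"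
  by (drule (1) schedule_of_work) (simp del: split_paired_All)

lemma schedule_of_idle:
  "schedule_of P \<Gamma> \<sigma> \<Longrightarrow> 0 \<le> t \<Longrightarrow> \<sigma> t = None \<Longrightarrow> \<not> pending \<Gamma> \<sigma> t j"
  by (drule (1) schedule_of_work) (simp del: split_paired_All)

text \<open>Service of \<open>j\<close> is constant just before \<open>f\<close>, so a job complete
  at \<open>f\<close> was complete a little earlier, and \<open>f\<close> is not its first
  completion. The time \<open>u\<close> keeps that earlier moment nonnegative and past the
  request.\<close>

lemma finishing_time_less_of_other_served:
  assumes rc: "right_const \<sigma>" and "0 \<le> u" "req \<Gamma> j \<le> u" "u < f"
    and fin: "finishing_time \<Gamma> \<sigma> j \<noteq> \<infinity>"
    and other: "\<forall>\<^sub>F x in at_left f. \<sigma> x \<noteq> Some j"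
  shows "finishing_time \<Gamma> \<sigma> j \<noteq> ereal f"
proof
  assume eq: "finishing_time \<Gamma> \<sigma> j = ereal f"
  obtain g where g: "finishing_time \<Gamma> \<sigma> j = ereal g" "cost \<Gamma> j \<le> service \<sigma> j g"
    "\<And>t. req \<Gamma> j \<le> t \<Longrightarrow> cost \<Gamma> j \<le> service \<sigma> j t \<Longrightarrow> g \<le> t"
    using finishing_time_attained[OF rc fin] by metis
  from g(1) eq have [simp]: "g = f" by simp
  obtain b where b: "b < f" "\<And>x. b < x \<Longrightarrow> x < f \<Longrightarrow> \<sigma> x \<noteq> Some j"
    using other by (auto simp: eventually_at_left_field)
  have "service \<sigma> j f = service \<sigma> j (max u b)"
    using assms b by (intro service_const[OF rc]) auto
  then have "f \<le> max u b" using g assms by auto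
  then show False using assms b by auto
qed

lemma finishing_time_distinct:
  assumes sched: "schedule_of P \<Gamma> \<sigma>" and "j1 \<noteq> j2" "0 \<le> u"
    and p: "pending \<Gamma> \<sigma> u j1" "pending \<Gamma> \<sigma> u j2"
    and fin: "finishing_time \<Gamma> \<sigma> j1 \<noteq> \<infinity>" "finishing_time \<Gamma> \<sigma> j2 \<noteq> \<infinity>"
  shows "finishing_time \<Gamma> \<sigma> j1 \<noteq> finishing_time \<Gamma> \<sigma> j2"
proof
  assume eq: "finishing_time \<Gamma> \<sigma> j1 = finishing_time \<Gamma> \<sigma> j2"
  note rc = schedule_of_right_const[OF sched]
  obtain f where f: "finishing_time \<Gamma> \<sigma> j1 = ereal f" "cost \<Gamma> j1 \<le> service \<sigma> j1 f"
    using finishing_time_attained[OF rc fin(1)] by metis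
  \<comment> \<open>This also gives \<open>0 < f\<close>, as the existence of a left limit at
    \<open>f\<close> requires.\<close>
  have "u < f"
    using f(2) p(1) service_mono[OF rc, of f u j1] by (force simp: pending_def)
  then obtain y where y: "\<forall>\<^sub>F x in at_left f. \<sigma> x = y"
    using schedule_of_left_limit[OF sched, of f] \<open>0 \<le> u\<close> by auto
  \<comment> \<open>The left limit \<open>y\<close> is a single value, so it differs from at least
    one of the two jobs.\<close>
  obtain j where j: "j \<in> {j1, j2}" "y \<noteq> Some j" using \<open>j1 \<noteq> j2\<close> by (metis insertCI option.inject)
  from y have "\<forall>\<^sub>F x in at_left f. \<sigma> x \<noteq> Some j"
    by eventually_elim (use j in simp)
  then have "finishing_time \<Gamma> \<sigma> j \<noteq> ereal f"
    using j p fin \<open>u < f\<close> \<open>0 \<le> u\<close>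
    by (intro finishing_time_less_of_other_served[OF rc, of u]) (auto simp: pending_def)
  then show False using j f eq by auto
qed

subsection \<open>Exchanging two jobs with equal deadlines\<close>

text \<open>The time slots of the pair stay in place and only change hands, so \<open>j1\<close> now
  completes once both jobs have completed in \<open>\<sigma>\<close>. Equal deadlines make the swap
  invisible to \<open>edf_free\<close>.\<close>

lemma edf_free_exchange:
  assumes sched: "schedule_of edf_free \<Gamma> \<sigma>" and ne: "j1 \<noteq> j2" and u: "0 \<le> u"
    and dl: "dl \<Gamma> j1 = dl \<Gamma> j2"
    and p1: "pending \<Gamma> \<sigma> u j1" and p2: "pending \<Gamma> \<sigma> u j2"
    and fin: "finishing_time \<Gamma> \<sigma> j2 \<noteq> \<infinity>"
  obtains \<sigma>' where "schedule_of edf_free \<Gamma> \<sigma>'" "finishing_time \<Gamma> \<sigma> j2 \<le> finishing_time \<Gamma> \<sigma>' j1"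
proof -
  note rc = schedule_of_right_const[OF sched]
  note pendD = schedule_of_pending[OF sched]
  \<comment> \<open>The exchange preserves the total service of the pair, so the two schedules can
    be compared through \<open>V\<close>.\<close>
  define V where "V t = service \<sigma> j1 t + service \<sigma> j2 t" for t
  have V_mono: "V s \<le> V t" if "s \<le> t" for s t
    unfolding V_def using that by (intro add_mono service_mono rc)
  have V_cont: "continuous_on S V" for S
    unfolding V_def by (intro continuous_intros continuous_on_service rc)
  have r: "req \<Gamma> j1 \<le> u" "req \<Gamma> j2 \<le> u" "is_job \<Gamma> j1" "is_job \<Gamma> j2"
    and s1: "service \<sigma> j1 u < cost \<Gamma> j1" and s2: "service \<sigma> j2 u < cost \<Gamma> j2"
    using p1 p2 by (auto simp: pending_def)
  \<comment> \<open>Being pending at \<open>u\<close> forces a positive cost, which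
    \<open>service_le_cost\<close> needs in the weaker form of nonnegativity.\<close>
  have c1: "service \<sigma> j1 t \<le> cost \<Gamma> j1" for t
    using s1 service_nonneg[of \<sigma> j1 u] by (intro service_le_cost[OF rc] pendD) auto
  have c2: "service \<sigma> j2 t \<le> cost \<Gamma> j2" for t
    using s2 service_nonneg[of \<sigma> j2 u] by (intro service_le_cost[OF rc] pendD) auto
  obtain f where f: "finishing_time \<Gamma> \<sigma> j2 = ereal f" "cost \<Gamma> j2 \<le> service \<sigma> j2 f"
    "\<And>t. req \<Gamma> j2 \<le> t \<Longrightarrow> cost \<Gamma> j2 \<le> service \<sigma> j2 t \<Longrightarrow> f \<le> t"
    using finishing_time_attained[OF rc fin] by metis
  have uf: "u \<le> f"
    using f(2) s2 service_mono[OF rc, of f u j2] by force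

  text \<open>\<open>T\<close> is the first time by which the service both jobs get from \<open>u\<close> on would complete \<open>j2\<close>.\<close>
  define F where "F = {t. u \<le> t \<and> V t = service \<sigma> j1 u + cost \<Gamma> j2}"
  define T where "T = Inf F"
  \<comment> \<open>At \<open>u\<close> the total is below the target since \<open>j2\<close> is
    incomplete; at \<open>f\<close> it has reached it, since \<open>j2\<close> is complete and
    \<open>j1\<close> has lost no service.\<close>
  have "\<exists>t\<ge>u. t \<le> f \<and> V t = service \<sigma> j1 u + cost \<Gamma> j2"
    using s2 f(2) service_mono[OF rc uf, of j1]
    by (intro IVT' uf V_cont) (auto simp: V_def)
  then have "F \<noteq> {}" by (auto simp: F_def)
  moreover have bdd: "bdd_below F" unfolding F_def by (rule bdd_belowI[of _ u]) auto
  moreover have "closed F" unfolding F_def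
    by (intro closed_Collect_conj closed_Collect_le closed_Collect_eq V_cont continuous_intros)
  ultimately have "T \<in> F" unfolding T_def by (intro closed_contains_Inf)
  then have uT: "u \<le> T" and VT: "V T = service \<sigma> j1 u + cost \<Gamma> j2" by (auto simp: F_def)
  \<comment> \<open>\<open>V\<close> can be flat while other jobs run; strictness comes from
    \<open>T\<close> being the first time at its level. It keeps \<open>j2\<close> pending as long
    as \<open>\<sigma>'\<close> may serve it.\<close>
  have V_less: "V t < V T" if "u \<le> t" "t < T" for t
  proof -
    have "t \<notin> F" using cInf_lower[OF _ bdd, of t] that by (auto simp: T_def)
    then have "V t \<noteq> V T" using that VT by (auto simp: F_def)
    then show ?thesis using V_mono[of t T] that by auto
  qed

  define \<sigma>' where "\<sigma>' x = (if u \<le> x \<and> \<sigma> x \<in> {Some j1, Some j2}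
    then (if x < T then Some j2 else Some j1) else \<sigma> x)" for x
  have rc': "right_const \<sigma>'"
    unfolding right_const_def
  proof (intro allI impI)
    fix t :: real assume "0 \<le> t"
    then have "\<forall>\<^sub>F x in at_right t. \<sigma> x = \<sigma> t" using rc by (simp add: right_const_def)
    \<comment> \<open>Both cuts in \<open>\<sigma>'\<close> are half-open, so each test keeps its
      value at \<open>t\<close> immediately to the right.\<close>
    moreover have "\<forall>\<^sub>F x in at_right t. (u \<le> x) = (u \<le> t)"
      unfolding eventually_at_right_field by (rule exI[of _ "if t < u then u else t + 1"]) auto
    moreover have "\<forall>\<^sub>F x in at_right t. (x < T) = (t < T)"
      unfolding eventually_at_right_field by (rule exI[of _ "if t < T then T else t + 1"]) auto
    ultimately show "\<forall>\<^sub>F x in at_right t. \<sigma>' x = \<sigma>' t"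
      by eventually_elim (auto simp: \<sigma>'_def)
  qed
  have left': "\<exists>y. \<forall>\<^sub>F x in at_left t. \<sigma>' x = y" if t: "0 < t" for t
  proof -
    obtain y where "\<forall>\<^sub>F x in at_left t. \<sigma> x = y"
      using schedule_of_left_limit[OF sched t] ..
    \<comment> \<open>From the left the tests agree with \<open>u < t\<close> and
      \<open>t \<le> T\<close>, which differ from their values at \<open>t\<close> when
      \<open>t\<close> is a cut.\<close>
    moreover have "\<forall>\<^sub>F x in at_left t. (u \<le> x) = (u < t)"
      unfolding eventually_at_left_field by (rule exI[of _ "if t \<le> u then t - 1 else u"]) auto
    moreover have "\<forall>\<^sub>F x in at_left t. (x < T) = (t \<le> T)"
      unfolding eventually_at_left_field by (rule exI[of _ "if t \<le> T then t - 1 else T"]) auto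
    ultimately have "\<forall>\<^sub>F x in at_left t. \<sigma>' x = (if u < t \<and> y \<in> {Some j1, Some j2}
        then (if t \<le> T then Some j2 else Some j1) else y)"
      by eventually_elim (auto simp: \<sigma>'_def)
    then show ?thesis by (rule exI)
  qed

  have other: "service \<sigma>' j t = service \<sigma> j t" if "j \<noteq> j1" "j \<noteq> j2" for j t
    unfolding service_def by (rule arg_cong[where f = "measure lebesgue"]) (use that in \<open>auto simp: \<sigma>'_def\<close>)
  have before: "service \<sigma>' j t = service \<sigma> j t" if "t \<le> u" for j t
    unfolding service_def by (rule arg_cong[where f = "measure lebesgue"]) (use that in \<open>auto simp: \<sigma>'_def\<close>)
  have merge: "measure lebesgue {x \<in> {a..<b}. \<sigma> x \<in> {Some j1, Some j2}} = V b - V a"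
    if ab: "u \<le> a" "a \<le> b" for a b
  proof -
    have a: "0 \<le> a" using u ab by simp
    have "{x \<in> {a..<b}. \<sigma> x \<in> {Some j1, Some j2}}
        = {x \<in> {a..<b}. \<sigma> x = Some j1} \<union> {x \<in> {a..<b}. \<sigma> x = Some j2}"
      by auto
    also have "measure lebesgue \<dots> = measure lebesgue {x \<in> {a..<b}. \<sigma> x = Some j1}
        + measure lebesgue {x \<in> {a..<b}. \<sigma> x = Some j2}"
      by (intro measure_Un_AE AE_I2 right_const_lmeasurable rc a) (use ne in auto)
    also have "\<dots> = V b - V a"
      unfolding V_def service_diff[OF rc a ab(2), symmetric] by simp
    finally show ?thesis .
  qed
  \<comment> \<open>Between \<open>u\<close> and \<open>T\<close> all slots of the pair go to
    \<open>j2\<close> and \<open>j1\<close> is frozen. At \<open>T\<close> the choice of the target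
    level makes the service of \<open>j2\<close> exactly its cost, and from then on all slots go to
    \<open>j1\<close>.\<close>
  have j2_early: "service \<sigma>' j2 t = V t - service \<sigma> j1 u" if "u \<le> t" "t \<le> T" for t
  proof -
    have "{x \<in> {u..<t}. \<sigma>' x = Some j2} = {x \<in> {u..<t}. \<sigma> x \<in> {Some j1, Some j2}}"
      using that by (auto simp: \<sigma>'_def)
    then show ?thesis
      using service_diff[OF rc', of u t j2] merge[of u t] that u before[of u j2]
      by (simp add: V_def)
  qed
  have j1_early: "service \<sigma>' j1 t = service \<sigma> j1 u" if "u \<le> t" "t \<le> T" for t
    using service_const[OF rc' u that(1), of j1] before[of u j1] that ne
    by (auto simp: \<sigma>'_def)
  have j2_late: "service \<sigma>' j2 t = cost \<Gamma> j2" if "T \<le> t" for t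
    using service_const[OF rc' _ that, of j2] j2_early[OF uT] that ne u uT VT
    by (auto simp: \<sigma>'_def)
  have j1_late: "service \<sigma>' j1 t = V t - cost \<Gamma> j2" if "T \<le> t" for t
  proof -
    have "{x \<in> {T..<t}. \<sigma>' x = Some j1} = {x \<in> {T..<t}. \<sigma> x \<in> {Some j1, Some j2}}"
      using that uT by (auto simp: \<sigma>'_def)
    then show ?thesis
      using service_diff[OF rc', of T t j1] merge[of T t] that u uT j1_early[of T] VT
      by simp
  qed

  have pend_before: "pending \<Gamma> \<sigma>' t j = pending \<Gamma> \<sigma> t j" if "t \<le> u" for t j
    using before[OF that] by (simp add: pending_def)
  have pend_other: "pending \<Gamma> \<sigma>' t j = pending \<Gamma> \<sigma> t j" if "j \<noteq> j1" "j \<noteq> j2" for t j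
    using other[OF that] by (simp add: pending_def)
  \<comment> \<open>From \<open>u\<close> on, some job of the pair is pending exactly while
    \<open>V\<close> is below the combined cost. The next three facts give the directions of this
    that are needed for the two schedules.\<close>
  have pend_V: "V t < cost \<Gamma> j1 + cost \<Gamma> j2" if "pending \<Gamma> \<sigma>' t j" "j \<in> {j1, j2}" "u \<le> t" for t j
    using that j1_late[of t] j2_late[of t] V_less[of t] VT s1
    by (cases "t < T") (auto simp: pending_def)
  have pend_some: "\<exists>i\<in>{j1, j2}. pending \<Gamma> \<sigma> t i"
    if "V t < cost \<Gamma> j1 + cost \<Gamma> j2" "u \<le> t" for t
    using that r by (auto simp: V_def pending_def)
  have V_pend: "V t < cost \<Gamma> j1 + cost \<Gamma> j2" if "pending \<Gamma> \<sigma> t j" "j \<in> {j1, j2}" for t j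
    using that c1[of t] c2[of t] by (auto simp: pending_def V_def)
  \<comment> \<open>Every job pending in \<open>\<sigma>'\<close> is matched by one pending in
    \<open>\<sigma>\<close> with the same deadline, so idleness and earliest-deadline comparisons
    carry over from \<open>\<sigma>\<close>.\<close>
  have counterpart: "\<exists>i. pending \<Gamma> \<sigma> t i \<and> dl \<Gamma> i = dl \<Gamma> j" if pj: "pending \<Gamma> \<sigma>' t j" for t j
  proof (cases "j \<in> {j1, j2} \<and> u \<le> t")
    case True
    then obtain i where "i \<in> {j1, j2}" "pending \<Gamma> \<sigma> t i"
      using pend_some[of t] pend_V[OF pj] by metis
    with True dl show ?thesis by (intro exI[of _ i]) auto
  next
    case False
    then show ?thesis using that pend_before[of t j] pend_other[of j t] by (intro exI[of _ j]) auto
  qed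
  have work: "case \<sigma>' t of None \<Rightarrow> \<forall>j. \<not> pending \<Gamma> \<sigma>' t j
      | Some j \<Rightarrow> pending \<Gamma> \<sigma>' t j \<and> (\<forall>j'. pending \<Gamma> \<sigma>' t j' \<longrightarrow> edf_free \<Gamma> j j')"
    if t: "0 \<le> t" for t
  proof (cases "\<sigma> t")
    case None
    then have none: "\<sigma>' t = None" by (simp add: \<sigma>'_def)
    have "\<not> pending \<Gamma> \<sigma>' t j" for j
      using counterpart[of t j] schedule_of_idle[OF sched t None] by auto
    with none show ?thesis by simp
  next
    case (Some i)
    have pol: "dl \<Gamma> i \<le> dl \<Gamma> j'" if pj': "pending \<Gamma> \<sigma>' t j'" for j'
    proof -
      obtain k where "pending \<Gamma> \<sigma> t k" "dl \<Gamma> k = dl \<Gamma> j'" using counterpart[OF pj'] by auto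
      then show ?thesis
        using schedule_of_policy[OF sched t Some, of k] by (simp add: edf_free_def)
    qed
    \<comment> \<open>The job served in \<open>\<sigma>'\<close> has the deadline of the job served
      in \<open>\<sigma>\<close>, so it inherits the bound \<open>pol\<close>.\<close>
    have "\<exists>k. \<sigma>' t = Some k \<and> pending \<Gamma> \<sigma>' t k \<and> dl \<Gamma> k = dl \<Gamma> i"
    proof (cases "i \<in> {j1, j2} \<and> u \<le> t")
      case True
      then have V: "V t < cost \<Gamma> j1 + cost \<Gamma> j2" using V_pend[OF pendD[OF t Some]] by simp
      show ?thesis
      proof (cases "t < T")
        case True2: True
        then have "\<sigma>' t = Some j2" using True Some by (auto simp: \<sigma>'_def)
        moreover have "pending \<Gamma> \<sigma>' t j2"
          using True True2 j2_early[of t] V_less[of t] VT r by (simp add: pending_def)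
        ultimately show ?thesis using True dl by (intro exI[of _ j2]) auto
      next
        case False
        then have "\<sigma>' t = Some j1" using True Some by (auto simp: \<sigma>'_def)
        moreover have "pending \<Gamma> \<sigma>' t j1"
          using True False j1_late[of t] V r by (simp add: pending_def)
        ultimately show ?thesis using True dl by (intro exI[of _ j1]) auto
      qed
    next
      case False
      then have "\<sigma>' t = Some i" using Some by (auto simp: \<sigma>'_def)
      then show ?thesis
        using pendD[OF t Some] False pend_before[of t i] pend_other[of i t]
        by (intro exI[of _ i]) auto
    qed
    then obtain k where k: "\<sigma>' t = Some k" "pending \<Gamma> \<sigma>' t k" "dl \<Gamma> k = dl \<Gamma> i"
      by auto
    then show ?thesis using pol by (simp add: edf_free_def)
  qed
  have sched': "schedule_of edf_free \<Gamma> \<sigma>'"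
    using rc' left' work by (simp add: schedule_of_def right_const_def)

  \<comment> \<open>Before \<open>f\<close>, but after \<open>u\<close>, \<open>j2\<close> is still
    pending in \<open>\<sigma>\<close>, so \<open>V\<close> is below the combined cost and
    \<open>j1\<close> cannot be complete in \<open>\<sigma>'\<close>.\<close>
  have "f \<le> t" if "cost \<Gamma> j1 \<le> service \<sigma>' j1 t" for t
  proof (rule ccontr)
    assume "\<not> f \<le> t"
    then have "t < f" by simp
    have "u < t"
      using that s1 before[of t j1] service_mono[OF rc, of t u j1] by force
    with \<open>t < f\<close> have "service \<sigma> j2 t < cost \<Gamma> j2"
      using f(3)[of t] r by (cases "cost \<Gamma> j2 \<le> service \<sigma> j2 t") auto
    with \<open>u < t\<close> have "pending \<Gamma> \<sigma> t j2" using r by (simp add: pending_def)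
    then show False
      using V_pend[of t j2] that j1_early[of t] j1_late[of t] s1 \<open>u < t\<close>
      by (cases "t < T") auto
  qed
  then have "finishing_time \<Gamma> \<sigma> j2 \<le> finishing_time \<Gamma> \<sigma>' j1"
    unfolding f(1) finishing_time_def[of \<Gamma> \<sigma>'] by (auto intro!: Inf_greatest)
  with sched' show thesis by (rule that)
qed

section \<open>Worst-case response times of two tied jobs\<close>

lemma response_time_le_wcrt:
  "schedule_of P \<Gamma> \<sigma> \<Longrightarrow> is_job \<Gamma> (i, e, n) \<Longrightarrow> response_time \<Gamma> \<sigma> (i, e, n) \<le> wcrt P \<Gamma> i"
  unfolding wcrt_def is_job_def by (rule Sup_upper) auto

text \<open>The exchange delays \<open>j1\<close> at least to the finish of \<open>j2\<close>, while
  the worst case already attained by \<open>j1\<close> bounds any such delay.\<close>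

lemma finishing_time_le_of_worst_case:
  assumes sched: "schedule_of edf_free \<Gamma> \<sigma>" and "j1 \<noteq> j2" "0 \<le> u" "dl \<Gamma> j1 = dl \<Gamma> j2"
    and p: "pending \<Gamma> \<sigma> u j1" "pending \<Gamma> \<sigma> u j2"
    and fin: "finishing_time \<Gamma> \<sigma> j2 \<noteq> \<infinity>"
    and worst: "response_time \<Gamma> \<sigma> j1 = wcrt edf_free \<Gamma> (fst j1)"
  shows "finishing_time \<Gamma> \<sigma> j2 \<le> finishing_time \<Gamma> \<sigma> j1"
proof -
  obtain \<sigma>' where \<sigma>': "schedule_of edf_free \<Gamma> \<sigma>'"
    "finishing_time \<Gamma> \<sigma> j2 \<le> finishing_time \<Gamma> \<sigma>' j1"
    using edf_free_exchange[OF assms(1-7)] by metis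
  have "response_time \<Gamma> \<sigma>' j1 \<le> response_time \<Gamma> \<sigma> j1"
    using response_time_le_wcrt[OF \<sigma>'(1), of "fst j1" "fst (snd j1)" "snd (snd j1)"] p(1) worst
    by (simp add: pending_def)
  \<comment> \<open>The request is a real number, so it cancels in \<open>ereal\<close>.\<close>
  then have "finishing_time \<Gamma> \<sigma>' j1 \<le> finishing_time \<Gamma> \<sigma> j1"
    unfolding response_time_def
    by (cases "finishing_time \<Gamma> \<sigma>' j1"; cases "finishing_time \<Gamma> \<sigma> j1") auto
  with \<sigma>'(2) show ?thesis by simp
qed

text \<open>Two attained worst cases bound each other's finishing times, forcing an equality that
  \<open>finishing_time_distinct\<close> forbids. Finite worst cases rule out a common finishing
  time \<infinity>.\<close>

lemma worst_cases_in_different_schedules: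
  assumes sched: "schedule_of edf_free \<Gamma> \<sigma>" and "j1 \<noteq> j2" "0 \<le> u" "dl \<Gamma> j1 = dl \<Gamma> j2"
    and p: "pending \<Gamma> \<sigma> u j1" "pending \<Gamma> \<sigma> u j2"
    and finite: "wcrt edf_free \<Gamma> (fst j1) \<noteq> \<infinity>" "wcrt edf_free \<Gamma> (fst j2) \<noteq> \<infinity>"
    and worst: "response_time \<Gamma> \<sigma> j1 = wcrt edf_free \<Gamma> (fst j1)"
  shows "response_time \<Gamma> \<sigma> j2 \<noteq> wcrt edf_free \<Gamma> (fst j2)"
proof
  assume worst2: "response_time \<Gamma> \<sigma> j2 = wcrt edf_free \<Gamma> (fst j2)"
  have fin: "finishing_time \<Gamma> \<sigma> j1 \<noteq> \<infinity>" "finishing_time \<Gamma> \<sigma> j2 \<noteq> \<infinity>"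
    using finite worst worst2 by (auto simp: response_time_def)
  have "finishing_time \<Gamma> \<sigma> j1 = finishing_time \<Gamma> \<sigma> j2"
    using finishing_time_le_of_worst_case[OF assms(1-4) p fin(2) worst]
      finishing_time_le_of_worst_case[OF sched _ \<open>0 \<le> u\<close> _ p(2,1) fin(1) worst2] assms(2,4)
    by simp
  then show False
    using finishing_time_distinct[OF sched assms(2,3) p fin] by simp
qed

theorem theorem8:
  fixes \<Gamma> :: "'i system" and \<tau> \<tau>' :: 'i and e\<^sub>0 n\<^sub>0 :: nat and t t\<^sub>a t\<^sub>b :: real
  assumes "\<And>i. wf_task (\<Gamma> i)"
    and "(e\<^sub>0, n\<^sub>0) \<in> jobs (\<Gamma> \<tau>)"
  shows
    "(let D = deadline (\<Gamma> \<tau>) e\<^sub>0 n\<^sub>0;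
          r = request (\<Gamma> \<tau>) e\<^sub>0 n\<^sub>0;
          D' = deadline (\<Gamma> \<tau>');
          r' = request (\<Gamma> \<tau>');
          C' = job_exec (\<Gamma> \<tau>');
          N = counted_jobs (\<Gamma> \<tau>') t t\<^sub>a t\<^sub>b;
          lhs = (\<Sum>\<^sub>\<infinity>(e, n)\<in>N. ennreal (C' e n *
                  (H_l (D - D' e n) + kronecker (D' e n) D * H_u (r - r' e n))));
          rhs = (\<Sum>\<^sub>\<infinity>(e, n)\<in>N. ennreal (C' e n * H_u (D - D' e n)))
      in lhs \<le> rhs
       \<and> lhs = interference_request_bound edf_by_request \<Gamma> (\<tau>, e\<^sub>0, n\<^sub>0) \<tau>' t t\<^sub>a t\<^sub>b
       \<and> rhs = interference_request_bound edf_free \<Gamma> (\<tau>, e\<^sub>0, n\<^sub>0) \<tau>' t t\<^sub>a t\<^sub>b)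
     \<and> wcrt edf_by_request \<Gamma> \<tau> \<le> wcrt edf_free \<Gamma> \<tau>
     \<and> (\<forall>\<sigma> \<sigma>' e n u.
          \<tau> \<noteq> \<tau>' \<and> (e, n) \<in> jobs (\<Gamma> \<tau>') \<and>
          deadline (\<Gamma> \<tau>') e n = deadline (\<Gamma> \<tau>) e\<^sub>0 n\<^sub>0 \<and>
          schedule_of edf_free \<Gamma> \<sigma> \<and> schedule_of edf_free \<Gamma> \<sigma>' \<and>
          pending \<Gamma> \<sigma> u (\<tau>, e\<^sub>0, n\<^sub>0) \<and> pending \<Gamma> \<sigma> u (\<tau>', e, n) \<and>
          wcrt edf_free \<Gamma> \<tau> \<noteq> \<infinity> \<and> wcrt edf_free \<Gamma> \<tau>' \<noteq> \<infinity> \<and>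
          response_time \<Gamma> \<sigma> (\<tau>, e\<^sub>0, n\<^sub>0) = wcrt edf_free \<Gamma> \<tau> \<and>
          response_time \<Gamma> \<sigma>' (\<tau>', e, n) = wcrt edf_free \<Gamma> \<tau>'
          \<longrightarrow> \<sigma> \<noteq> \<sigma>')"
proof -
  have exec: "0 \<le> job_exec (\<Gamma> \<tau>') e n" if "(e, n) \<in> counted_jobs (\<Gamma> \<tau>') t t\<^sub>a t\<^sub>b" for e n
    using assms(1)[of \<tau>'] that by (auto simp: wf_task_def counted_jobs_def)
  \<comment> \<open>Schedules are constrained only from time 0 on, and no job is pending before its
    request.\<close>
  have nonneg: "0 \<le> u" if "pending \<Gamma> \<sigma> u (\<tau>, e\<^sub>0, n\<^sub>0)" for \<sigma> u
  proof -
    have "events (\<Gamma> \<tau>) ! e\<^sub>0 \<in> set (events (\<Gamma> \<tau>))"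
      using assms(2) by (auto simp: jobs_def)
    then have "0 \<le> request (\<Gamma> \<tau>) e\<^sub>0 n\<^sub>0"
      using assms(1)[of \<tau>] by (auto simp: wf_task_def request_def)
    then show ?thesis using that by (simp add: pending_def req_def)
  qed
  show ?thesis
    unfolding Let_def
  proof (intro conjI allI impI)
    show "wcrt edf_by_request \<Gamma> \<tau> \<le> wcrt edf_free \<Gamma> \<tau>"
      by (rule wcrt_mono) (auto simp: edf_by_request_def edf_free_def)
  next
    fix \<sigma> \<sigma>' e n u
    assume H: "\<tau> \<noteq> \<tau>' \<and> (e, n) \<in> jobs (\<Gamma> \<tau>') \<and>
          deadline (\<Gamma> \<tau>') e n = deadline (\<Gamma> \<tau>) e\<^sub>0 n\<^sub>0 \<and>
          schedule_of edf_free \<Gamma> \<sigma> \<and> schedule_of edf_free \<Gamma> \<sigma>' \<and>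
          pending \<Gamma> \<sigma> u (\<tau>, e\<^sub>0, n\<^sub>0) \<and> pending \<Gamma> \<sigma> u (\<tau>', e, n) \<and>
          wcrt edf_free \<Gamma> \<tau> \<noteq> \<infinity> \<and> wcrt edf_free \<Gamma> \<tau>' \<noteq> \<infinity> \<and>
          response_time \<Gamma> \<sigma> (\<tau>, e\<^sub>0, n\<^sub>0) = wcrt edf_free \<Gamma> \<tau> \<and>
          response_time \<Gamma> \<sigma>' (\<tau>', e, n) = wcrt edf_free \<Gamma> \<tau>'"
    then have "response_time \<Gamma> \<sigma> (\<tau>', e, n) \<noteq> wcrt edf_free \<Gamma> \<tau>'"
      using worst_cases_in_different_schedules[of \<Gamma> \<sigma> "(\<tau>, e\<^sub>0, n\<^sub>0)" "(\<tau>', e, n)" u] nonneg[of \<sigma> u]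
      by (simp add: dl_def)
    with H show "\<sigma> \<noteq> \<sigma>'" by auto
  \<comment> \<open>The weight on the left is the indicator of an earlier deadline, or an equal one
    with no later request. Its two summands are never nonzero together, so it stays below
    \<open>H_u\<close>.\<close>
  qed (intro weighted_interference_mono interference_request_bound_eq exec;
      auto simp: H_l_def H_u_def kronecker_def edf_free_def edf_by_request_def dl_def req_def)+
qed

end
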